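(* Let $n\in\mathbb{N}_+$, $r_1,\ldots,r_n\ge 2$ integers, $s,t\in[n]$. If $\mathcal{S}\subseteq\mathcal{N}$ is a connected $(s,t)$-switchable set, then the ideal $\widetilde{I}^{\langle s,t\rangle}_{\mathcal{S}}$ of $R$ is prime.
   Context: Notation: $[r]=\{1,\ldots,r\}$, $\mathcal{N}=[r_1]\times\cdots\times[r_n]$, $\Bbbk$ is an arbitrary field. Two indices $a,b\in\mathcal{N}$ are $s$-equivalent if $\sum_{i=1}^s a_i=\sum_{i=1}^s b_i$ and $a_i=b_i$ for $i=s+1,\ldots,n$. $R=\Bbbk[x_a: a\in\mathcal{N}]$ is the polynomial ring where the variables are identified by $x_a=x_b$ if and only if $a,b$ are $s$-equivalent (so variables correspond bijectively to $s$-equivalence classes). For $i\in[n]$ and $a,b\in\mathcal{N}$, $\mathrm{sw}(i,a,b)\in\mathcal{N}$ is obtained from $a$ by replacing its $i$-th component by $b_i$; $f_{i,a,b}=x_ax_b-x_{\mathrm{sw}(i,a,b)}x_{\mathrm{sw}(i,b,a)}$; $\mathrm{d}(a,b)=\#\{i\in[n]: a_i\ne b_i\}$. A subset $\mathcal{S}\subseteq\mathcal{N}$ is $(s,t)$-switchable if (i) for all $a,b\in\mathcal{S}$ with $\mathrm{d}(a,b)=2$ and all $i\in[t]$, $\mathrm{sw}(i,a,b)\in\mathcal{S}$; and (ii) $\mathcal{S}$ is closed under $s$-equivalence. Indices $a,b\in\mathcal{S}$ are connected in $\mathcal{S}$ if there are $c_0=a,c_1,\ldots,c_k=b$ in $\mathcal{S}$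 with $\mathrm{d}(c_{j-1},c_j)=1$ for all $j\in[k]$; $\mathcal{S}$ is connected if any two of its elements are connected in $\mathcal{S}$. The ideal $\widetilde{I}^{\langle s,t\rangle}_{\mathcal{S}}\subseteq R$ is generated by all $f_{i,a,b}$ with $i\in[t]$ and $a,b$ connected in $\mathcal{S}$. *)

theory Defs
  imports "HOL-Library.Poly_Mapping" "HOL-Algebra.Ideal"
begin

text \<open>Polynomials over a field are finitely supported maps from monomials to coefficients, where a
  monomial is a finitely supported map from variables to exponents. The set of variables is not a
  type here, so the polynomial ring in the variables from \<open>V\<close> is given by its carrier.\<close>

type_synonym ('v, 'k) mpoly = "('v \<Rightarrow>\<^sub>0 nat) \<Rightarrow>\<^sub>0 'k"

definition mpoly_ring :: "'v set \<Rightarrow> ('v, 'k::field) mpoly ring" where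
  "mpoly_ring V = \<lparr>carrier = {p. \<forall>m \<in> Poly_Mapping.keys p. Poly_Mapping.keys m \<subseteq> V},
     mult = (*), one = 1, zero = 0, add = (+)\<rparr>"

definition mpoly_var :: "'v \<Rightarrow> ('v, 'k::field) mpoly" where
  "mpoly_var v = Poly_Mapping.single (Poly_Mapping.single v 1) 1"

text \<open>An element of \<open>[r\<^sub>1] \<times> \<dots> \<times> [r\<^sub>n]\<close> is a function that is \<open>undefined\<close> outside \<open>{1..n}\<close>.\<close>

type_synonym multi_index = "nat \<Rightarrow> nat"

definition index_set :: "nat \<Rightarrow> (nat \<Rightarrow> nat) \<Rightarrow> multi_index set" where
  "index_set n r = (\<Pi>\<^sub>E i\<in>{1..n}. {1..r i})"

definition s_equiv :: "nat \<Rightarrow> nat \<Rightarrow> multi_index \<Rightarrow> multi_index \<Rightarrow> bool" where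
  "s_equiv n s a b \<longleftrightarrow> (\<Sum>i=1..s. a i) = (\<Sum>i=1..s. b i) \<and> (\<forall>i\<in>{s+1..n}. a i = b i)"

definition s_class :: "nat \<Rightarrow> (nat \<Rightarrow> nat) \<Rightarrow> nat \<Rightarrow> multi_index \<Rightarrow> multi_index set" where
  "s_class n r s a = {b \<in> index_set n r. s_equiv n s a b}"

text \<open>The variables of \<open>R\<close> are the \<open>s\<close>-equivalence classes themselves.\<close>

definition R_ring :: "nat \<Rightarrow> (nat \<Rightarrow> nat) \<Rightarrow> nat \<Rightarrow> (multi_index set, 'k::field) mpoly ring" where
  "R_ring n r s = mpoly_ring (s_class n r s ` index_set n r)"

definition x_var :: "nat \<Rightarrow> (nat \<Rightarrow> nat) \<Rightarrow> nat \<Rightarrow> multi_index \<Rightarrow> (multi_index set, 'k::field) mpoly" where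
  "x_var n r s a = mpoly_var (s_class n r s a)"

definition sw :: "nat \<Rightarrow> multi_index \<Rightarrow> multi_index \<Rightarrow> multi_index" where
  "sw i a b = a(i := b i)"

definition f_poly :: "nat \<Rightarrow> (nat \<Rightarrow> nat) \<Rightarrow> nat \<Rightarrow> nat \<Rightarrow> multi_index \<Rightarrow> multi_index \<Rightarrow>
    (multi_index set, 'k::field) mpoly" where
  "f_poly n r s i a b =
     x_var n r s a * x_var n r s b - x_var n r s (sw i a b) * x_var n r s (sw i b a)"

definition index_dist :: "nat \<Rightarrow> multi_index \<Rightarrow> multi_index \<Rightarrow> nat" where
  "index_dist n a b = card {i \<in> {1..n}. a i \<noteq> b i}"

definition switchable :: "nat \<Rightarrow> (nat \<Rightarrow> nat) \<Rightarrow> nat \<Rightarrow> nat \<Rightarrow> multi_index set \<Rightarrow> bool" where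
  "switchable n r s t S \<longleftrightarrow> S \<subseteq> index_set n r \<and>
     (\<forall>a\<in>S. \<forall>b\<in>S. index_dist n a b = 2 \<longrightarrow> (\<forall>i\<in>{1..t}. sw i a b \<in> S)) \<and>
     (\<forall>a\<in>S. \<forall>b\<in>index_set n r. s_equiv n s a b \<longrightarrow> b \<in> S)"

definition connected_in :: "nat \<Rightarrow> multi_index set \<Rightarrow> multi_index \<Rightarrow> multi_index \<Rightarrow> bool" where
  "connected_in n S a b \<longleftrightarrow> (\<exists>(k::nat) c. c 0 = a \<and> c k = b \<and> (\<forall>j\<in>{0..k}. c j \<in> S) \<and>
     (\<forall>j\<in>{1..k}. index_dist n (c (j - 1)) (c j) = 1))"

definition connected_set :: "nat \<Rightarrow> multi_index set \<Rightarrow> bool" where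
  "connected_set n S \<longleftrightarrow> (\<forall>a\<in>S. \<forall>b\<in>S. connected_in n S a b)"

definition I_tilde :: "nat \<Rightarrow> (nat \<Rightarrow> nat) \<Rightarrow> nat \<Rightarrow> nat \<Rightarrow> multi_index set \<Rightarrow>
    (multi_index set, 'k::field) mpoly set" where
  "I_tilde n r s t S = genideal (R_ring n r s)
     {f_poly n r s i a b | i a b. i \<in> {1..t} \<and> a \<in> S \<and> b \<in> S \<and> connected_in n S a b}"

end

theory Submission
  imports Defs "HOL-Library.Multiset"
begin

text \<open>The ideal is toric: it is the kernel of a homomorphism that sends every variable to a monomial
  of a polynomial ring, hence it is prime because that ring is a domain.

  Connectedness upgrades the switching axiom: \<open>S\<close> is closed under \<open>sw i\<close> for all \<open>i \<le> t\<close>, at any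
  distance (\<open>sw_closed\<close>). So every generator trades one product of two variables indexed by \<open>S\<close> for
  another, and the trade preserves some numerical statistics of a product of variables indexed by
  \<open>S\<close>: how often each tuple of coordinates beyond \<open>max s t\<close> occurs; for \<open>s < i \<le> t\<close> (and also for
  \<open>i = 1\<close> if \<open>s = 1\<close>), how often each value of the \<open>i\<close>-th coordinate occurs; and the total of the
  heights \<open>a\<^sub>1 + \<dots> + a\<^sub>s\<close>. Variables with an index outside \<open>S\<close> occur in no generator and are just
  counted. These statistics are the exponents of the monomial map.

  By \<open>primeideal_toric\<close> it remains to see that two monomials with the same statistics are congruent
  modulo the ideal. Since only the class of an index matters, monomials are multisets of indices up
  to \<open>s\<close>-equivalence, and it suffices to move any prescribed element \<open>a\<close> of the first multiset into
  the second one, cancel it, and repeat (\<open>exchanges_if_same_stats\<close>). The statistics provide an element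
  that agrees with \<open>a\<close> beyond \<open>max s t\<close>, and for each further coordinate beyond \<open>s\<close> a partner from
  which to switch in the right value; if \<open>s = 1\<close>, the first coordinate is treated likewise, and \<open>a\<close> is
  reached. If \<open>s \<ge> 2\<close>, the height is left to adjust, and this happens one unit at a time (\<open>transfer_height\<close>): two switches in the first coordinate, with an \<open>s\<close>-equivalence
  between them, raise the height of one index by \<open>1\<close> at the expense of another, unless the first
  height is maximal or the second one is minimal.\<close>

abbreviation "keys \<equiv> Poly_Mapping.keys"
abbreviation "lookup \<equiv> Poly_Mapping.lookup"

section \<open>A primality criterion for binomial ideals\<close>

lemma mpoly_ring_simps [simp]:
  "carrier (mpoly_ring V) = {p. \<forall>m \<in> keys p. keys m \<subseteq> V}"
  "p \<otimes>\<^bsub>mpoly_ring V\<^esub> q = p * q" "\<one>\<^bsub>mpoly_ring V\<^esub> = 1"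
  "\<zero>\<^bsub>mpoly_ring V\<^esub> = 0" "p \<oplus>\<^bsub>mpoly_ring V\<^esub> q = p + q"
  by (simp_all add: mpoly_ring_def)

lemma keys_uminus: "keys (- p) = keys (p :: 'a \<Rightarrow>\<^sub>0 'b::ab_group_add)"
  by (auto simp: in_keys_iff)

lemma mpoly_carrier_minus:
  "p \<in> carrier (mpoly_ring V) \<Longrightarrow> q \<in> carrier (mpoly_ring V)
    \<Longrightarrow> p - q \<in> carrier (mpoly_ring V)"
  using keys_add[of p "- q"] by (auto simp: keys_uminus)

lemma mpoly_carrier_times:
  assumes "p \<in> carrier (mpoly_ring V)" and "q \<in> carrier (mpoly_ring V)"
  shows "p * q \<in> carrier (mpoly_ring V)"
proof -
  have "keys m \<subseteq> V" if m: "m \<in> keys (p * q)" for m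
  proof -
    obtain a b where "m = a + b" "a \<in> keys p" "b \<in> keys q"
      using keys_mult[of p q] m by blast
    then show ?thesis
      using keys_add[of a b] assms by auto
  qed
  then show ?thesis by simp
qed

lemma cring_mpoly_ring: "cring (mpoly_ring V :: ('v, 'k::field) mpoly ring)"
proof (rule cringI)
  show "abelian_group (mpoly_ring V :: ('v, 'k) mpoly ring)"
  proof (rule abelian_groupI)
    fix x y :: "('v, 'k) mpoly"
    assume "x \<in> carrier (mpoly_ring V)" and "y \<in> carrier (mpoly_ring V)"
    then show "x \<oplus>\<^bsub>mpoly_ring V\<^esub> y \<in> carrier (mpoly_ring V)"
      using keys_add[of x y] by auto
  next
    fix x :: "('v, 'k) mpoly"
    assume "x \<in> carrier (mpoly_ring V)"
    then show "\<exists>y\<in>carrier (mpoly_ring V). y \<oplus>\<^bsub>mpoly_ring V\<^esub> x = \<zero>\<^bsub>mpoly_ring V\<^esub>"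
      by (intro bexI[of _ "- x"]) (auto simp: keys_uminus)
  qed (auto simp: add_ac)
  show "Group.comm_monoid (mpoly_ring V :: ('v, 'k) mpoly ring)"
  proof (rule comm_monoidI)
    fix x y :: "('v, 'k) mpoly"
    assume "x \<in> carrier (mpoly_ring V)" and "y \<in> carrier (mpoly_ring V)"
    then show "x \<otimes>\<^bsub>mpoly_ring V\<^esub> y \<in> carrier (mpoly_ring V)"
      using mpoly_carrier_times[of x V y] by simp
  qed (auto simp: mult_ac)
qed (auto simp: distrib_right)

definition mset_monom :: "'v multiset \<Rightarrow> 'v \<Rightarrow>\<^sub>0 nat" where
  "mset_monom A = (\<Sum>v\<in>#A. Poly_Mapping.single v 1)"

lemma mset_monom_simps [simp]:
  "mset_monom {#} = 0"
  "mset_monom (add_mset v A) = Poly_Mapping.single v 1 + mset_monom A"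
  by (simp_all add: mset_monom_def)

lemma lookup_mset_monom: "lookup (mset_monom A) v = count A v"
  by (induction A) (auto simp: lookup_add lookup_single when_def)

lemma keys_mset_monom: "keys (mset_monom A) = set_mset A"
  by (auto simp: in_keys_iff lookup_mset_monom)

lemma mset_monom_surj: "\<exists>A. m = mset_monom A"
proof
  have "count (Abs_multiset (lookup m)) = lookup m"
    by (rule count_Abs_multiset) simp
  then show "m = mset_monom (Abs_multiset (lookup m))"
    by (intro poly_mapping_eqI) (simp add: lookup_mset_monom)
qed

lemma prod_mpoly_var:
  "(\<Prod>v\<in>#A. mpoly_var v) = Poly_Mapping.single (mset_monom A) 1"
  by (induction A) (simp_all add: mpoly_var_def mult_single)

definition weighted_degree :: "('v \<Rightarrow> nat) \<Rightarrow> ('v \<Rightarrow>\<^sub>0 nat) \<Rightarrow> nat" where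
  "weighted_degree f m = (\<Sum>v\<in>keys m. lookup m v * f v)"

lemma weighted_degree_superset:
  assumes "finite W" and "keys m \<subseteq> W"
  shows "weighted_degree f m = (\<Sum>v\<in>W. lookup m v * f v)"
  unfolding weighted_degree_def
  by (rule sum.mono_neutral_left) (use assms in \<open>auto simp: in_keys_iff\<close>)

lemma weighted_degree_add:
  "weighted_degree f (m + m') = weighted_degree f m + weighted_degree f m'"
proof -
  let ?W = "keys m \<union> keys m'"
  have "weighted_degree f (m + m') = (\<Sum>v\<in>?W. lookup (m + m') v * f v)"
    "weighted_degree f m = (\<Sum>v\<in>?W. lookup m v * f v)"
    "weighted_degree f m' = (\<Sum>v\<in>?W. lookup m' v * f v)"
    using keys_add[of m m'] by (auto intro!: weighted_degree_superset)
  then show ?thesis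
    by (simp add: lookup_add distrib_right sum.distrib)
qed

lemma weighted_degree_0 [simp]: "weighted_degree f 0 = 0"
  by (simp add: weighted_degree_def)

lemma weighted_degree_mset_monom: "weighted_degree f (mset_monom A) = (\<Sum>v\<in>#A. f v)"
proof (induction A)
  case (add v A)
  have "weighted_degree f (Poly_Mapping.single v 1) = f v"
    by (simp add: weighted_degree_def)
  with add show ?case by (simp add: weighted_degree_add)
qed simp

text \<open>The linear extension of a map of monomials; it is multiplicative when the map of monomials is
  additive in the exponents.\<close>

definition push_monomials :: "('m \<Rightarrow> 'w) \<Rightarrow> ('m \<Rightarrow>\<^sub>0 'k::comm_ring_1) \<Rightarrow> ('w \<Rightarrow>\<^sub>0 'k)" where
  "push_monomials w p = (\<Sum>m\<in>keys p. Poly_Mapping.single (w m) (lookup p m))"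

lemma push_monomials_superset:
  assumes "finite W" and "keys p \<subseteq> W"
  shows "push_monomials w p = (\<Sum>m\<in>W. Poly_Mapping.single (w m) (lookup p m))"
  unfolding push_monomials_def
  by (rule sum.mono_neutral_left) (use assms in \<open>auto simp: in_keys_iff\<close>)

lemma push_monomials_add:
  "push_monomials w (p + q) = push_monomials w p + push_monomials w q"
proof -
  let ?W = "keys p \<union> keys q"
  have "push_monomials w (p + q) = (\<Sum>m\<in>?W. Poly_Mapping.single (w m) (lookup (p + q) m))"
    "push_monomials w p = (\<Sum>m\<in>?W. Poly_Mapping.single (w m) (lookup p m))"
    "push_monomials w q = (\<Sum>m\<in>?W. Poly_Mapping.single (w m) (lookup q m))"
    using keys_add[of p q] by (auto intro!: push_monomials_superset)
  then show ?thesis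
    by (simp add: lookup_add single_add sum.distrib)
qed

lemma push_monomials_0 [simp]: "push_monomials w 0 = 0"
  by (simp add: push_monomials_def)

lemma push_monomials_single [simp]:
  "push_monomials w (Poly_Mapping.single m c) = Poly_Mapping.single (w m) c"
  by (cases "c = 0") (simp_all add: push_monomials_def)

lemma push_monomials_diff:
  "push_monomials w (p - q) = push_monomials w p - push_monomials w q"
  using push_monomials_add[of w "p - q" q] by (simp add: eq_diff_eq)

lemma push_monomials_sum:
  "push_monomials w (\<Sum>i\<in>I. p i) = (\<Sum>i\<in>I. push_monomials w (p i))"
  by (induction I rule: infinite_finite_induct) (simp_all add: push_monomials_add)

lemma sum_singles: "p = (\<Sum>m\<in>keys p. Poly_Mapping.single m (lookup p m))"
  by (rule poly_mapping_eqI)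
    (auto simp: lookup_sum lookup_single when_def not_in_keys_iff_lookup_eq_zero)

lemma push_monomials_mult:
  assumes "\<And>m m'. w (m + m') = w m + w m'"
  shows "push_monomials w (p * q) = push_monomials w p * push_monomials w q"
proof -
  let ?s = "Poly_Mapping.single"
  have "p * q = (\<Sum>m\<in>keys p. ?s m (lookup p m)) * (\<Sum>m'\<in>keys q. ?s m' (lookup q m'))"
    using sum_singles[of p] sum_singles[of q] by simp
  also have "\<dots> = (\<Sum>m\<in>keys p. \<Sum>m'\<in>keys q. ?s (m + m') (lookup p m * lookup q m'))"
    by (simp add: sum_product mult_single)
  finally show ?thesis
    by (simp add: push_monomials_sum assms push_monomials_def[of w p] push_monomials_def[of w q]
        sum_product mult_single)
qed

text \<open>The functions in \<open>F\<close> are the exponents of a monomial map \<open>\<psi>\<close> into a polynomial ring over \<open>nat\<close>-indexed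
  variables, which is a domain because its monomials are linearly ordered. The hypothesis on \<open>G\<close> says
  that the ideal lies in the kernel of \<open>\<psi>\<close>. For the converse, replace each monomial of a polynomial in
  the kernel by a representative of its fibre: by \<open>fibre\<close> this changes the polynomial by an element of
  the ideal, and the result is zero since the coefficients in each fibre cancel.\<close>

theorem primeideal_toric:
  fixes V :: "'v set" and G :: "('v, 'k::field) mpoly set" and F :: "('v \<Rightarrow> nat) set"
  assumes "finite F"
    and gen: "\<And>g. g \<in> G \<Longrightarrow> \<exists>A B. set_mset A \<subseteq> V \<and> set_mset B \<subseteq> V \<and>
      g = (\<Prod>v\<in>#A. mpoly_var v) - (\<Prod>v\<in>#B. mpoly_var v) \<and>
      (\<forall>f\<in>F. (\<Sum>v\<in>#A. f v) = (\<Sum>v\<in>#B. f v))"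
    and fibre: "\<And>A B. set_mset A \<subseteq> V \<Longrightarrow> set_mset B \<subseteq> V \<Longrightarrow>
      (\<And>f. f \<in> F \<Longrightarrow> (\<Sum>v\<in>#A. f v) = (\<Sum>v\<in>#B. f v)) \<Longrightarrow>
      (\<Prod>v\<in>#A. mpoly_var v) - (\<Prod>v\<in>#B. mpoly_var v) \<in> genideal (mpoly_ring V) G"
  shows "primeideal (genideal (mpoly_ring V) G) (mpoly_ring V)"
proof -
  let ?R = "mpoly_ring V :: ('v, 'k) mpoly ring"
  interpret R: cring ?R by (rule cring_mpoly_ring)
  obtain fs where fs: "set fs = F" using \<open>finite F\<close> finite_list by blast
  define w :: "('v \<Rightarrow>\<^sub>0 nat) \<Rightarrow> (nat \<Rightarrow>\<^sub>0 nat)" where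
    "w m = (\<Sum>j<length fs. Poly_Mapping.single j (weighted_degree (fs ! j) m))" for m
  have w_add: "w (m + m') = w m + w m'" for m m'
    by (simp add: w_def weighted_degree_add single_add sum.distrib)
  have lookup_w: "lookup (w m) j = (if j < length fs then weighted_degree (fs ! j) m else 0)"
    for m j
    by (auto simp: w_def lookup_sum lookup_single when_def)
  have w_eq_iff: "w m = w m' \<longleftrightarrow> (\<forall>f\<in>F. weighted_degree f m = weighted_degree f m')" for m m'
  proof -
    have "w m = w m' \<longleftrightarrow>
        (\<forall>j<length fs. weighted_degree (fs ! j) m = weighted_degree (fs ! j) m')"
      by (auto simp: poly_mapping_eq_iff fun_eq_iff lookup_w)
    then show ?thesis
      unfolding fs[symmetric] by (simp add: all_set_conv_all_nth)
  qed
  define \<psi> :: "('v, 'k) mpoly \<Rightarrow> (nat \<Rightarrow>\<^sub>0 nat) \<Rightarrow>\<^sub>0 'k" where "\<psi> = push_monomials w"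
  have psi_mult: "\<psi> (p * q) = \<psi> p * \<psi> q" for p q
    unfolding \<psi>_def by (rule push_monomials_mult) (rule w_add)
  have psi_one: "\<psi> 1 = 1"
  proof -
    have "w 0 = 0" by (simp add: w_def)
    then show ?thesis
      unfolding \<psi>_def using push_monomials_single[of w 0 1] by simp
  qed
  let ?K = "{p \<in> carrier ?R. \<psi> p = 0}"
  let ?I = "genideal ?R G"
  have psi_binomial: "\<psi> ((\<Prod>v\<in>#A. mpoly_var v) - (\<Prod>v\<in>#B. mpoly_var v)) = 0"
    if "\<forall>f\<in>F. (\<Sum>v\<in>#A. f v) = (\<Sum>v\<in>#B. f v)" for A B
  proof -
    have "w (mset_monom A) = w (mset_monom B)"
      using that by (simp add: w_eq_iff weighted_degree_mset_monom)
    then show ?thesis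
      by (simp add: \<psi>_def prod_mpoly_var push_monomials_diff)
  qed
  have G_K: "G \<subseteq> ?K"
  proof
    fix g assume "g \<in> G"
    then obtain A B where AB: "set_mset A \<subseteq> V" "set_mset B \<subseteq> V"
      "g = (\<Prod>v\<in>#A. mpoly_var v) - (\<Prod>v\<in>#B. mpoly_var v)"
      "\<forall>f\<in>F. (\<Sum>v\<in>#A. f v) = (\<Sum>v\<in>#B. f v)"
      using gen by blast
    have "(\<Prod>v\<in>#A. mpoly_var v) \<in> carrier ?R" "(\<Prod>v\<in>#B. mpoly_var v) \<in> carrier ?R"
      using AB by (simp_all add: prod_mpoly_var keys_mset_monom)
    with AB psi_binomial[OF AB(4)] show "g \<in> ?K"
      using mpoly_carrier_minus by blast
  qed
  have G_carrier: "G \<subseteq> carrier ?R" using G_K by blast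
  have ideal_K: "ideal ?K ?R"
  proof (rule idealI)
    show "Ring.ring ?R" by (rule R.ring_axioms)
    show "subgroup ?K (add_monoid ?R)"
    proof (rule R.add.subgroupI)
      show "?K \<noteq> {}" by (auto simp: \<psi>_def intro!: exI[of _ 0])
    next
      fix a assume a: "a \<in> ?K"
      have "\<ominus>\<^bsub>?R\<^esub> a = - a"
        by (rule R.minus_equality) (use a in \<open>auto simp: keys_uminus\<close>)
      then show "\<ominus>\<^bsub>?R\<^esub> a \<in> ?K"
        using a push_monomials_diff[of w 0 a] by (auto simp: keys_uminus \<psi>_def)
    next
      fix a b assume "a \<in> ?K" and "b \<in> ?K"
      then show "a \<oplus>\<^bsub>?R\<^esub> b \<in> ?K"
        using R.add.m_closed[of a b] by (auto simp: \<psi>_def push_monomials_add)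
    qed auto
  next
    fix a x assume "a \<in> ?K" and "x \<in> carrier ?R"
    then show "x \<otimes>\<^bsub>?R\<^esub> a \<in> ?K" and "a \<otimes>\<^bsub>?R\<^esub> x \<in> ?K"
      using mpoly_carrier_times[of x V a] mpoly_carrier_times[of a V x]
      by (simp_all add: psi_mult)
  qed
  interpret I: ideal ?I ?R by (rule R.genideal_ideal[OF G_carrier])
  have I_sum: "(\<Sum>x\<in>X. h x) \<in> ?I" if "\<And>x. x \<in> X \<Longrightarrow> h x \<in> ?I"
    for X :: "('v \<Rightarrow>\<^sub>0 nat) set" and h
    using that
  proof (induction X rule: infinite_finite_induct)
    case (insert x X)
    then show ?case using I.a_closed[of "h x" "\<Sum>x\<in>X. h x"] by simp
  qed (use I.zero_closed in simp_all)
  have "?K \<subseteq> ?I"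
  proof
    fix p assume p: "p \<in> ?K"
    let ?s = "Poly_Mapping.single :: _ \<Rightarrow> 'k \<Rightarrow> _"
    \<comment> \<open>one monomial of \<open>p\<close> in each fibre of \<open>w\<close>\<close>
    define rep where "rep e = (SOME m. m \<in> keys p \<and> w m = e)" for e
    have rep: "rep (w m) \<in> keys p \<and> w (rep (w m)) = w m" if "m \<in> keys p" for m
      unfolding rep_def by (rule someI) (use that in simp)
    \<comment> \<open>The representative depends on \<open>w m\<close> only, so the sum factors through \<open>\<psi> p = 0\<close>.\<close>
    have "(\<Sum>m\<in>keys p. ?s (rep (w m)) (lookup p m)) = push_monomials rep (\<psi> p)"
      by (simp add: \<psi>_def push_monomials_def[of w p] push_monomials_sum)
    then have zero: "(\<Sum>m\<in>keys p. ?s (rep (w m)) (lookup p m)) = 0"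
      using p by simp
    have "p = (\<Sum>m\<in>keys p. ?s m (lookup p m) - ?s (rep (w m)) (lookup p m))"
      using zero sum_singles[of p] by (simp add: sum_subtractf)
    also have "\<dots> \<in> ?I"
    proof (rule I_sum)
      fix m assume m: "m \<in> keys p"
      obtain A B where A: "m = mset_monom A" and B: "rep (w m) = mset_monom B"
        using mset_monom_surj by metis
      have "set_mset A \<subseteq> V" "set_mset B \<subseteq> V"
        using p m rep[OF m] A B by (auto simp: keys_mset_monom[symmetric])
      moreover have "(\<Sum>v\<in>#A. f v) = (\<Sum>v\<in>#B. f v)" if "f \<in> F" for f
      proof -
        have "weighted_degree f m = weighted_degree f (rep (w m))"
          using rep[OF m] that w_eq_iff[of m "rep (w m)"] by auto
        then show ?thesis
          unfolding B unfolding A by (simp add: weighted_degree_mset_monom)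
      qed
      ultimately have "(\<Prod>v\<in>#A. mpoly_var v) - (\<Prod>v\<in>#B. mpoly_var v) \<in> ?I"
        by (rule fibre)
      then have "?s m 1 - ?s (rep (w m)) 1 \<in> ?I"
        by (simp only: prod_mpoly_var A[symmetric] B[symmetric])
      then have "?s 0 (lookup p m) * (?s m 1 - ?s (rep (w m)) 1) \<in> ?I"
        using I.I_l_closed[of _ "?s 0 (lookup p m)"] by simp
      then show "?s m (lookup p m) - ?s (rep (w m)) (lookup p m) \<in> ?I"
        by (simp add: right_diff_distrib mult_single)
    qed
    finally show "p \<in> ?I" .
  qed
  moreover have "?I \<subseteq> ?K" by (rule R.genideal_minimal[OF ideal_K G_K])
  ultimately have I_eq: "?I = ?K" by blast
  show ?thesis
  proof (rule primeideal.intro)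
    show "primeideal_axioms ?I ?R"
    proof
      have "(1 :: ('v, 'k) mpoly) \<in> carrier ?R" "(1 :: ('v, 'k) mpoly) \<notin> ?K"
        by (simp_all add: psi_one)
      then show "carrier ?R \<noteq> ?I" unfolding I_eq by blast
    next
      fix a b assume "a \<in> carrier ?R" "b \<in> carrier ?R" "a \<otimes>\<^bsub>?R\<^esub> b \<in> ?I"
      then show "a \<in> ?I \<or> b \<in> ?I"
        unfolding I_eq by (auto simp: psi_mult)
    qed
  qed (rule I.ideal_axioms R.cring_axioms)+
qed

section \<open>Multi-indices and multisets\<close>

lemma index_dist_1E:
  assumes "index_dist n a b = 1"
  obtains j where "j \<in> {1..n}" and "a j \<noteq> b j" and "\<And>i. i \<in> {1..n} \<Longrightarrow> i \<noteq> j \<Longrightarrow> a i = b i"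
proof -
  obtain j where "{i \<in> {1..n}. a i \<noteq> b i} = {j}"
    using assms unfolding index_dist_def by (rule card_1_singletonE)
  then show ?thesis by (intro that[of j]) blast+
qed

lemma index_set_eqI:
  assumes "a \<in> index_set n r" and "b \<in> index_set n r" and "\<And>i. i \<in> {1..n} \<Longrightarrow> a i = b i"
  shows "a = b"
  using assms unfolding index_set_def by (rule PiE_ext)

lemma index_set_outside:
  "a \<in> index_set n r \<Longrightarrow> b \<in> index_set n r \<Longrightarrow> i \<notin> {1..n} \<Longrightarrow> a i = b i"
  unfolding index_set_def by (metis PiE_arb)

lemma index_set_upd:
  "a \<in> index_set n r \<Longrightarrow> i \<in> {1..n} \<Longrightarrow> v \<in> {1..r i} \<Longrightarrow> a(i := v) \<in> index_set n r"
  by (auto simp: index_set_def PiE_iff extensional_def)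

lemma index_set_range: "a \<in> index_set n r \<Longrightarrow> i \<in> {1..n} \<Longrightarrow> a i \<in> {1..r i}"
  unfolding index_set_def by blast

lemma s_class_eq_iff:
  assumes "a \<in> index_set n r" and "b \<in> index_set n r"
  shows "s_class n r s a = s_class n r s b \<longleftrightarrow> s_equiv n s a b"
proof
  assume "s_class n r s a = s_class n r s b"
  moreover have "b \<in> s_class n r s b" using assms by (simp add: s_class_def s_equiv_def)
  ultimately have "b \<in> s_class n r s a" by simp
  then show "s_equiv n s a b" by (simp add: s_class_def)
next
  assume "s_equiv n s a b"
  then show "s_class n r s a = s_class n r s b"
    unfolding s_class_def s_equiv_def by auto
qed

text \<open>A statistic that is smaller at \<open>b\<close> than at some element of \<open>A\<close> must be made up for by the remaining
  elements.\<close>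

lemma sum_mset_pos_transfer:
  fixes f :: "'a \<Rightarrow> nat"
  assumes "a \<in># A" and "f b < f a" and "(\<Sum>x\<in>#A. f x) = (\<Sum>x\<in>#add_mset b B. f x)"
  shows "\<exists>c\<in>#B. 0 < f c"
proof -
  obtain A' where "A = add_mset a A'" using assms(1) by (rule mset_add)
  with assms(3) have "f a + (\<Sum>x\<in>#A'. f x) = f b + (\<Sum>x\<in>#B. f x)" by simp
  with assms(2) have "(\<Sum>x\<in>#B. f x) \<noteq> 0" by linarith
  then obtain c where "c \<in># B" "f c \<noteq> 0" by (auto simp: sum_mset_0_iff)
  then show ?thesis by auto
qed

section \<open>Switches in a connected switchable set\<close>

locale connected_switchable =
  fixes n s t :: nat and r :: "nat \<Rightarrow> nat" and S :: "multi_index set"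
  assumes r_ge_2: "\<And>i. i \<in> {1..n} \<Longrightarrow> 2 \<le> r i"
    and s_range: "s \<in> {1..n}" and t_range: "t \<in> {1..n}"
    and switchable: "switchable n r s t S" and connected: "connected_set n S"
begin

abbreviation "J \<equiv> index_set n r"
abbreviation "cls \<equiv> s_class n r s"

lemma S_J: "a \<in> S \<Longrightarrow> a \<in> J"
  using switchable by (auto simp: switchable_def)

lemma S_range: "a \<in> S \<Longrightarrow> i \<in> {1..n} \<Longrightarrow> 1 \<le> a i \<and> a i \<le> r i"
  using index_set_range[OF S_J] by simp

lemma S_cls: "a \<in> S \<Longrightarrow> b \<in> J \<Longrightarrow> cls a = cls b \<Longrightarrow> b \<in> S"
  using switchable S_J s_class_eq_iff unfolding switchable_def by metis

text \<open>Induction on a path from \<open>a\<close> to \<open>b\<close>: the switch \<open>e\<close> of the second vertex with \<open>b\<close> lies in \<open>S\<close>. If the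
  first step of the path changes coordinate \<open>i\<close>, then \<open>e\<close> is already the switch of \<open>a\<close>. Otherwise \<open>e\<close>
  differs from \<open>a\<close> at most in coordinate \<open>i\<close> and in the coordinate changed by that step, so the
  switching axiom for distance \<open>2\<close> applies.\<close>

lemma sw_closed:
  assumes "a \<in> S" and "b \<in> S" and i: "i \<in> {1..t}"
  shows "sw i a b \<in> S"
proof -
  have path: "sw i (c 0) (c k) \<in> S"
    if "\<forall>j\<in>{0..k}. c j \<in> S" and "\<forall>j\<in>{1..k}. index_dist n (c (j - 1)) (c j) = 1" for c and k :: nat
    using that
  proof (induction k arbitrary: c)
    case 0
    then show ?case by (simp add: sw_def)
  next
    case (Suc k)
    let ?e = "sw i (c 1) (c (Suc k))"
    have e: "?e \<in> S"
    proof -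
      have "\<forall>j\<in>{0..k}. c (Suc j) \<in> S" using Suc.prems(1) by auto
      moreover have "index_dist n (c (Suc (j - 1))) (c (Suc j)) = 1" if "j \<in> {1..k}" for j
        using Suc.prems(2) that by (force dest: bspec[of _ _ "Suc j"])
      ultimately show ?thesis using Suc.IH[of "\<lambda>j. c (Suc j)"] by simp
    qed
    have c: "c 0 \<in> S" "c 1 \<in> S" "c (Suc k) \<in> S" using Suc.prems(1) by auto
    have "index_dist n (c 0) (c 1) = 1" using Suc.prems(2) by force
    then obtain j where j: "j \<in> {1..n}" "c 0 j \<noteq> c 1 j"
      "\<And>l. l \<in> {1..n} \<Longrightarrow> l \<noteq> j \<Longrightarrow> c 0 l = c 1 l" by (rule index_dist_1E) blast
    have out: "c 0 l = c 1 l" if "l \<noteq> j" for l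
    proof (cases "l \<in> {1..n}")
      case False
      then show ?thesis using c S_J index_set_outside by blast
    qed (use j that in auto)
    consider "j = i" | "j \<noteq> i" "c 0 i = c (Suc k) i" | "j \<noteq> i" "c 0 i \<noteq> c (Suc k) i" by blast
    then show ?case
    proof cases
      case 1
      then have "sw i (c 0) (c (Suc k)) = ?e" using out by (auto simp: sw_def)
      with e show ?thesis by simp
    next
      case 2
      then have "sw i (c 0) (c (Suc k)) = c 0" by (simp add: sw_def fun_upd_idem)
      with c show ?thesis by simp
    next
      case 3
      have "{l \<in> {1..n}. c 0 l \<noteq> ?e l} = {i, j}"
        using 3 j out i t_range by (auto simp: sw_def)
      then have "index_dist n (c 0) ?e = 2"
        using 3 by (simp add: index_dist_def)
      then have "sw i (c 0) ?e \<in> S"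
        using switchable c e i unfolding switchable_def by blast
      moreover have "sw i (c 0) ?e = sw i (c 0) (c (Suc k))" unfolding sw_def by simp
      ultimately show ?thesis by (rule subst[rotated, where P = "\<lambda>x. x \<in> S"])
    qed
  qed
  have "connected_in n S a b" using connected assms by (simp add: connected_set_def)
  then show ?thesis
    unfolding connected_in_def
  proof (elim exE conjE)
    fix k :: nat and c
    assume "c 0 = a" and "c k = b" and "\<forall>j\<in>{0..k}. c j \<in> S"
      and "\<forall>j\<in>{1..k}. index_dist n (c (j - 1)) (c j) = 1"
    with path[of k c] show ?thesis by simp
  qed
qed

section \<open>Statistics of monomials\<close>

definition height :: "multi_index \<Rightarrow> nat" where
  "height a = (\<Sum>i=1..s. a i)"

definition max_height :: nat where
  "max_height = (\<Sum>i=1..s. r i)"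

text \<open>For an index in \<open>S\<close>, the set of elements of \<open>S\<close> with the same coordinates beyond \<open>max s t\<close>; these
  are the coordinates that neither a switch nor an \<open>s\<close>-equivalence changes. Labels inside and outside
  \<open>S\<close> are disjoint sets, so a label also tells whether its index lies in \<open>S\<close>.\<close>

definition label :: "multi_index \<Rightarrow> multi_index set" where
  "label a = (if a \<in> S then {b \<in> S. \<forall>i\<in>{max s t + 1..n}. b i = a i} else cls a)"

text \<open>The coordinates that can be switched and are well defined on \<open>s\<close>-classes. For \<open>s = 1\<close> the
  equivalence is trivial, and the first coordinate is one of them.\<close>

definition free_coords :: "nat set" where
  "free_coords = {i \<in> {1..t}. s < i \<or> s = 1}"

text \<open>The height enters twice, as the distance from the least and from the greatest possible height.
  Equal totals of both show that an index that is too low (too high) is compensated by another one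
  above the minimum (below the maximum), without a count of the indices in \<open>S\<close>.\<close>

definition stats :: "(multi_index \<Rightarrow> nat) set" where
  "stats = (\<lambda>C a. of_bool (label a = C)) ` label ` J
     \<union> (\<lambda>(i, v) a. of_bool (a \<in> S \<and> a i = v)) ` (SIGMA i:free_coords. {1..r i})
     \<union> {\<lambda>a. if a \<in> S then height a - s else 0, \<lambda>a. if a \<in> S then max_height - height a else 0}"

lemma finite_stats: "finite stats"
proof -
  have "finite J" unfolding index_set_def by (intro finite_PiE) auto
  moreover have "finite free_coords" by (simp add: free_coords_def)
  ultimately show ?thesis unfolding stats_def by simp
qed

lemma height_bounds:
  assumes "a \<in> S"
  shows "s \<le> height a" and "height a \<le> max_height"
proof -
  have "1 \<le> a i \<and> a i \<le> r i" if "i \<in> {1..s}" for i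
    using S_range[OF assms] that s_range by simp
  then have "(\<Sum>i=1..s. 1) \<le> height a" and "height a \<le> max_height"
    unfolding height_def max_height_def by (intro sum_mono; simp)+
  then show "s \<le> height a" and "height a \<le> max_height" by simp_all
qed

lemma height_upd:
  assumes "i \<in> {1..s}"
  shows "height (a(i := v)) + a i = height a + v"
  using assms by (simp add: height_def sum.remove)

lemma height_upd_outside: "i \<notin> {1..s} \<Longrightarrow> height (a(i := v)) = height a"
  unfolding height_def by (intro sum.cong) auto

lemma height_sw: "height (sw i a b) + height (sw i b a) = height a + height b"
proof (cases "i \<in> {1..s}")
  case True
  then show ?thesis
    using height_upd[of i a "b i"] height_upd[of i b "a i"] by (simp add: sw_def)
qed (simp add: sw_def height_upd_outside)

lemma label_eq_iff_S:
  assumes "a \<in> S" and "b \<in> S"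
  shows "label b = label a \<longleftrightarrow> (\<forall>i\<in>{max s t + 1..n}. b i = a i)"
  using assms by (auto simp: label_def set_eq_iff)

lemma label_eq_S:
  assumes "a \<in> J" and "b \<in> J" and "label a = label b"
  shows "a \<in> S \<longleftrightarrow> b \<in> S"
proof -
  have mem: "c \<in> label c" if "c \<in> J" for c
    using that by (simp add: label_def s_class_def s_equiv_def)
  have sub: "label c \<subseteq> S" if "c \<in> S" for c
    using that by (auto simp: label_def)
  from mem[OF assms(1)] mem[OF assms(2)] sub assms(3) show ?thesis by blast
qed

lemma label_sw:
  assumes "i \<in> {1..t}" and "a \<in> S" and "b \<in> S"
  shows "label (sw i a b) = label a"
  using assms sw_closed by (subst label_eq_iff_S) (auto simp: sw_def)

lemma stats_cases:
  assumes "f \<in> stats"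
  obtains (label) C where "f = (\<lambda>a. of_bool (label a = C))"
  | (coord) i v where "i \<in> free_coords" and "f = (\<lambda>a. of_bool (a \<in> S \<and> a i = v))"
  | (low) "f = (\<lambda>a. if a \<in> S then height a - s else 0)"
  | (high) "f = (\<lambda>a. if a \<in> S then max_height - height a else 0)"
  using assms unfolding stats_def by auto

lemma stats_sw:
  assumes "f \<in> stats" and i: "i \<in> {1..t}" and ab: "a \<in> S" "b \<in> S"
  shows "f (sw i a b) + f (sw i b a) = f a + f b"
proof -
  have S: "sw i a b \<in> S" "sw i b a \<in> S" using i ab sw_closed by auto
  show ?thesis using assms(1)
  proof (cases rule: stats_cases)
    case (label C)
    then show ?thesis using i ab by (simp add: label_sw)
  next
    case (coord j v)
    then show ?thesis using ab S by (simp add: sw_def)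
  next
    case low
    then show ?thesis
      using ab S height_sw[of i a b] height_bounds(1)[OF ab(1)] height_bounds(1)[OF ab(2)]
        height_bounds(1)[OF S(1)] height_bounds(1)[OF S(2)] by simp
  next
    case high
    then show ?thesis
      using ab S height_sw[of i a b] height_bounds(2)[OF ab(1)] height_bounds(2)[OF ab(2)]
        height_bounds(2)[OF S(1)] height_bounds(2)[OF S(2)] by simp
  qed
qed

lemma cls_eq_iff:
  assumes "a \<in> J" and "b \<in> J"
  shows "cls a = cls b \<longleftrightarrow> height a = height b \<and> (\<forall>i\<in>{s+1..n}. a i = b i)"
  using s_class_eq_iff[OF assms] by (simp add: s_equiv_def height_def)

lemma stats_cls:
  assumes "f \<in> stats" and J: "a \<in> J" "b \<in> J" and c: "cls a = cls b"
  shows "f a = f b"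
proof -
  have S: "a \<in> S \<longleftrightarrow> b \<in> S" using S_cls J c by metis
  have h: "height a = height b" and eq: "\<And>i. i \<in> {s+1..n} \<Longrightarrow> a i = b i"
    using c cls_eq_iff[OF J] by auto
  have lab: "label a = label b"
  proof (cases "a \<in> S")
    case True
    moreover have "a i = b i" if "i \<in> {max s t + 1..n}" for i
      by (rule eq) (use that in \<open>simp add: max_def split: if_splits\<close>)
    ultimately show ?thesis using S by (simp add: label_eq_iff_S)
  qed (use S c in \<open>simp add: label_def\<close>)
  have "a i = b i" if "i \<in> free_coords" for i
  proof (cases "s < i")
    case True
    then show ?thesis using eq[of i] that t_range by (simp add: free_coords_def)
  next
    case False
    then have "s = 1" "i = 1" using that by (auto simp: free_coords_def)
    then show ?thesis using h[unfolded height_def] by simp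
  qed
  with assms(1) S h lab show ?thesis
    by (cases rule: stats_cases) auto
qed

section \<open>Connecting monomials with equal statistics\<close>

text \<open>The moves that change a product of variables only modulo the ideal: the switches of the generators,
  and the choice of another index for the same variable.\<close>

inductive exchange :: "multi_index multiset \<Rightarrow> multi_index multiset \<Rightarrow> bool" where
  switch: "exchange (add_mset a (add_mset b M)) (add_mset (sw i a b) (add_mset (sw i b a) M))"
  if "i \<in> {1..t}" and "a \<in> S" and "b \<in> S"
| rename: "exchange (add_mset a M) (add_mset b M)"
  if "a \<in> J" and "b \<in> J" and "cls a = cls b"

abbreviation exchanges (infix "\<leadsto>" 50) where "exchanges \<equiv> exchange\<^sup>*\<^sup>*"

lemma exchanges_switch:
  "i \<in> {1..t} \<Longrightarrow> a \<in> S \<Longrightarrow> b \<in> S \<Longrightarrow>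
    add_mset a (add_mset b M) \<leadsto> add_mset (sw i a b) (add_mset (sw i b a) M)"
  by (blast intro: exchange.switch)

lemma exchanges_rename:
  "a \<in> J \<Longrightarrow> b \<in> J \<Longrightarrow> cls a = cls b \<Longrightarrow> add_mset a M \<leadsto> add_mset b M"
  by (blast intro: exchange.rename)

lemma exchange_add: "exchange M N \<Longrightarrow> exchange (add_mset c M) (add_mset c N)"
proof (induction rule: exchange.induct)
  case (switch i a b M)
  then show ?case
    using exchange.switch[of i a b "add_mset c M"] by (simp add: add_mset_commute)
next
  case (rename a b M)
  then show ?case
    using exchange.rename[of a b "add_mset c M"] by (simp add: add_mset_commute)
qed

lemma exchanges_add: "M \<leadsto> N \<Longrightarrow> add_mset c M \<leadsto> add_mset c N"
  by (induction rule: rtranclp_induct) (auto intro: exchange_add rtranclp.rtrancl_into_rtrancl)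

definition same_stats :: "multi_index multiset \<Rightarrow> multi_index multiset \<Rightarrow> bool" where
  "same_stats M N \<longleftrightarrow> (\<forall>f\<in>stats. (\<Sum>a\<in>#M. f a) = (\<Sum>a\<in>#N. f a))"

lemma same_stats_trans: "same_stats L M \<Longrightarrow> same_stats M N \<Longrightarrow> same_stats L N"
  by (simp add: same_stats_def)

lemma same_statsD: "same_stats M N \<Longrightarrow> f \<in> stats \<Longrightarrow> (\<Sum>a\<in>#M. f a) = (\<Sum>a\<in>#N. f a)"
  by (simp add: same_stats_def)

lemma exchange_invariants:
  assumes "exchange M N"
  shows "same_stats M N" and "set_mset M \<subseteq> J \<Longrightarrow> set_mset N \<subseteq> J"
  using assms
proof (induction rule: exchange.induct)
  case (switch i a b M)
  {
    case 1
    show ?case using stats_sw[OF _ switch] by (simp add: same_stats_def add.assoc[symmetric])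
  next
    case 2
    then show ?case using switch sw_closed S_J by auto
  }
next
  case (rename a b M)
  {
    case 1
    show ?case using stats_cls[OF _ rename] by (simp add: same_stats_def)
  next
    case 2
    then show ?case using rename by auto
  }
qed

lemma exchanges_invariants:
  assumes "M \<leadsto> N"
  shows "same_stats M N" and "set_mset M \<subseteq> J \<Longrightarrow> set_mset N \<subseteq> J"
  using assms by (induction rule: rtranclp_induct)
    (use exchange_invariants in \<open>auto simp: same_stats_def\<close>)

text \<open>Moving one unit between two of the first \<open>s\<close> coordinates stays in the class, hence in \<open>S\<close>.\<close>

lemma shift_unit:
  assumes c: "c \<in> S" and ij: "i \<in> {1..s}" "j \<in> {1..s}" "i \<noteq> j" and "c i < r i" and "1 < c j"
  shows "c(i := Suc (c i), j := c j - 1) \<in> S"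
    and "cls (c(i := Suc (c i), j := c j - 1)) = cls c"
proof -
  let ?c = "c(i := Suc (c i), j := c j - 1)"
  have n: "i \<in> {1..n}" "j \<in> {1..n}" using ij s_range by auto
  have "c j - 1 \<in> {1..r j}" using S_range[OF c n(2)] \<open>1 < c j\<close> by auto
  then have J: "?c \<in> J"
    using \<open>c i < r i\<close> n by (intro index_set_upd S_J[OF c]) auto
  have "height ?c = height c"
    using height_upd[OF ij(1), of c "Suc (c i)"] ij(3) \<open>1 < c j\<close>
      height_upd[OF ij(2), of "c(i := Suc (c i))" "c j - 1"] by simp
  then have "cls c = cls ?c"
    using cls_eq_iff[OF S_J[OF c] J] ij by simp
  with S_cls[OF c J] show "?c \<in> S" and "cls ?c = cls c" by simp_all
qed

text \<open>If the first coordinate is maximal, some other one is not, and a unit can be moved there.\<close>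

lemma representative_below_top:
  assumes a: "a \<in> S" "height a < max_height"
  shows "\<exists>c\<in>S. cls c = cls a \<and> c 1 < r 1"
proof (cases "a 1 < r 1")
  case True
  with a show ?thesis by blast
next
  case False
  have one: "1 \<in> {1..s}" "1 \<in> {1..n}" using s_range by auto
  have "\<exists>j\<in>{1..s}. a j < r j"
  proof (rule ccontr)
    assume "\<not> (\<exists>j\<in>{1..s}. a j < r j)"
    then have "max_height \<le> height a"
      unfolding height_def max_height_def by (intro sum_mono) (simp add: not_less)
    with a show False by simp
  qed
  then obtain j where j: "j \<in> {1..s}" "a j < r j" by blast
  have a1: "a 1 = r 1" using False S_range[OF a(1) one(2)] by simp
  then have "j \<noteq> 1" "1 < a 1" using j r_ge_2[OF one(2)] by auto
  note move = shift_unit[OF a(1) j(1) one(1) \<open>j \<noteq> 1\<close> j(2) \<open>1 < a 1\<close>]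
  show ?thesis
    using a1 \<open>1 < a 1\<close> by (intro bexI[OF _ move(1)] conjI move(2)) simp
qed

text \<open>If the coordinates \<open>2, \<dots>, s\<close> are all minimal, the excess height sits in the first coordinate,
  and a unit of it can be moved to the second.\<close>

lemma representative_above_bottom:
  assumes "2 \<le> s" and b: "b \<in> S" "s < height b"
  shows "\<exists>c\<in>S. \<exists>j\<in>{2..s}. cls c = cls b \<and> 1 < c j"
proof (cases "\<exists>j\<in>{2..s}. 1 < b j")
  case True
  with b show ?thesis by blast
next
  case False
  then have le: "b j \<le> 1" if "2 \<le> j" "j \<le> s" for j using that by (simp add: not_less)
  have two: "1 \<in> {1..s}" "2 \<in> {1..s}" "2 \<in> {1..n}" "2 \<in> {2..s}"
    using \<open>2 \<le> s\<close> s_range by auto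
  have b1: "1 < b 1"
  proof (rule ccontr)
    assume "\<not> 1 < b 1"
    then have "b i \<le> 1" if "i \<in> {1..s}" for i
      using le[of i] that by (cases "i = 1") auto
    then have "height b \<le> (\<Sum>i=1..s. 1)" unfolding height_def by (rule sum_mono)
    with b show False by simp
  qed
  have b2: "b 2 = 1" "b 2 < r 2"
    using le[of 2] \<open>2 \<le> s\<close> r_ge_2[OF two(3)] S_range[OF b(1) two(3)] by auto
  note move = shift_unit[OF b(1) two(2,1) _ b2(2) b1]
  show ?thesis
    using b2 by (intro bexI[OF _ move(1)] bexI[OF _ two(4)] conjI move(2)) simp_all
qed

text \<open>Write \<open>a\<close> and \<open>b\<close> by their coordinates \<open>1\<close> and \<open>j\<close>, chosen such that \<open>a\<^sub>1\<close> is not maximal and \<open>b\<^sub>j\<close> is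
  not minimal. Switching the first coordinate turns \<open>(a\<^sub>1, a\<^sub>j), (b\<^sub>1, b\<^sub>j)\<close> into \<open>(b\<^sub>1, a\<^sub>j), (a\<^sub>1, b\<^sub>j)\<close>.
  The second index is equivalent to \<open>(a\<^sub>1 + 1, b\<^sub>j - 1)\<close>, and switching the first coordinate back
  yields \<open>(a\<^sub>1 + 1, a\<^sub>j), (b\<^sub>1, b\<^sub>j - 1)\<close>. Coordinate \<open>1\<close> is chosen because it can be switched
  whatever \<open>t\<close> is.\<close>

lemma transfer_height:
  assumes "2 \<le> s" and a: "a \<in> S" "height a < max_height" and b: "b \<in> S" "s < height b"
  obtains a' b' where "a' \<in> S" and "height a' = Suc (height a)" and "\<And>i. s < i \<Longrightarrow> a' i = a i"
    and "b' \<in> S" and "Suc (height b') = height b" and "\<And>i. s < i \<Longrightarrow> b' i = b i"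
    and "\<And>M. add_mset a (add_mset b M) \<leadsto> add_mset a' (add_mset b' M)"
proof -
  have one: "1 \<in> {1..s}" "1 \<in> {1..t}" using \<open>2 \<le> s\<close> t_range by auto
  obtain a0 where a0: "a0 \<in> S" "cls a0 = cls a" "a0 1 < r 1"
    using representative_below_top[OF a] by blast
  obtain b0 j where b0: "b0 \<in> S" "cls b0 = cls b" "j \<in> {2..s}" "1 < b0 j"
    using representative_above_bottom[OF \<open>2 \<le> s\<close> b] by blast
  define c where "c = sw 1 a0 b0"
  define d where "d = sw 1 b0 a0"
  define e where "e = d(1 := Suc (d 1), j := d j - 1)"
  have cd: "c \<in> S" "d \<in> S" using sw_closed a0 b0 one by (auto simp: c_def d_def)
  have j: "j \<in> {1..s}" "j \<noteq> 1" "1 \<noteq> j" using b0(3) by auto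
  have e: "e \<in> S" "cls e = cls d"
    using shift_unit[OF cd(2) one(1) j(1,3)] a0(3) b0(4) j(2) by (simp_all add: e_def d_def sw_def)
  let ?a = "sw 1 c e" and ?b = "sw 1 e c"
  have S': "?a \<in> S" "?b \<in> S" using sw_closed cd e one by auto
  have a': "?a = a0(1 := Suc (a0 1))" and b': "?b = b0(j := b0 j - 1)"
    using j unfolding c_def e_def d_def sw_def by (auto intro!: ext)
  show ?thesis
  proof (rule that[of ?a ?b])
    have ha: "height a0 = height a \<and> (\<forall>i\<in>{s+1..n}. a0 i = a i)"
      using cls_eq_iff[OF S_J[OF a0(1)] S_J[OF a(1)]] a0(2) by simp
    have hb: "height b0 = height b \<and> (\<forall>i\<in>{s+1..n}. b0 i = b i)"
      using cls_eq_iff[OF S_J[OF b0(1)] S_J[OF b(1)]] b0(2) by simp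
    have out: "x i = y i" if "x \<in> S" "y \<in> S" "\<forall>i\<in>{s+1..n}. x i = y i" "s < i" for x y i
    proof (cases "i \<in> {1..n}")
      case False
      then show ?thesis using index_set_outside[OF S_J[OF that(1)] S_J[OF that(2)]] by blast
    qed (use that in auto)
    show "height ?a = Suc (height a)"
      unfolding a' using height_upd[OF one(1), of a0 "Suc (a0 1)"] ha by simp
    show "Suc (height ?b) = height b"
      unfolding b' using height_upd[OF j(1), of b0 "b0 j - 1"] hb b0(4) by simp
    show "?a i = a i" if "s < i" for i
      unfolding a' using out[OF a0(1) a(1) _ that] ha that \<open>2 \<le> s\<close> by simp
    show "?b i = b i" if "s < i" for i
      unfolding b' using out[OF b0(1) b(1) _ that] hb that j by simp
    show "add_mset a (add_mset b M) \<leadsto> add_mset ?a (add_mset ?b M)" for M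
    proof -
      have 1: "add_mset a (add_mset b M) \<leadsto> add_mset a0 (add_mset b M)"
        by (rule exchanges_rename[OF S_J[OF a(1)] S_J[OF a0(1)] a0(2)[symmetric]])
      have 2: "add_mset a0 (add_mset b M) \<leadsto> add_mset a0 (add_mset b0 M)"
        by (rule exchanges_add[OF exchanges_rename[OF S_J[OF b(1)] S_J[OF b0(1)] b0(2)[symmetric]]])
      have 3: "add_mset a0 (add_mset b0 M) \<leadsto> add_mset c (add_mset d M)"
        unfolding c_def d_def by (rule exchanges_switch[OF one(2) a0(1) b0(1)])
      have 4: "add_mset c (add_mset d M) \<leadsto> add_mset c (add_mset e M)"
        by (rule exchanges_add[OF exchanges_rename[OF S_J[OF cd(2)] S_J[OF e(1)] e(2)[symmetric]]])
      have 5: "add_mset c (add_mset e M) \<leadsto> add_mset ?a (add_mset ?b M)"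
        by (rule exchanges_switch[OF one(2) cd(1) e(1)])
      show ?thesis
        by (rule rtranclp_trans[OF 1 rtranclp_trans[OF 2 rtranclp_trans[OF 3 rtranclp_trans[OF 4 5]]]])
    qed
  qed (use S' in simp_all)
qed

text \<open>Each application of \<open>transfer_height\<close> brings the height of \<open>a'\<close> one unit closer to that of \<open>a\<close>; the
  equality of statistics provides the partner.\<close>

lemma reach_height:
  assumes "2 \<le> s" and "a \<in># M" and "a \<in> S"
    and "a' \<in> S" and "\<And>i. s < i \<Longrightarrow> a' i = a i" and "same_stats M (add_mset a' N)"
  shows "\<exists>N'. add_mset a' N \<leadsto> add_mset a N'"
  using assms(4-)
proof (induction "nat \<bar>int (height a) - int (height a')\<bar>" arbitrary: a' N rule: less_induct)
  case less
  have low: "(\<lambda>a. if a \<in> S then height a - s else 0) \<in> stats"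
    and high: "(\<lambda>a. if a \<in> S then max_height - height a else 0) \<in> stats"
    by (simp_all add: stats_def)
  note bounds = height_bounds[OF \<open>a \<in> S\<close>] height_bounds[OF \<open>a' \<in> S\<close>]
  consider "height a' = height a" | "height a' < height a" | "height a < height a'" by linarith
  then show ?case
  proof cases
    case 1
    then have "cls a' = cls a"
      using less.prems assms(3) S_J by (subst cls_eq_iff) auto
    then show ?thesis using exchanges_rename less.prems(1) assms(3) S_J by blast
  next
    case 2
    have "\<exists>b\<in>#N. 0 < (if b \<in> S then height b - s else 0)"
      using less.prems(3) low
      by (intro sum_mset_pos_transfer[OF assms(2), of _ a'])
        (use 2 bounds less.prems(1) assms(3) in \<open>auto simp: same_stats_def\<close>)
    then obtain b where b: "b \<in># N" "b \<in> S" "s < height b"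
      by (metis less_numeral_extra(3) zero_less_diff)
    then obtain N0 where N0: "N = add_mset b N0" by (meson mset_add)
    obtain c d where c: "c \<in> S" "height c = Suc (height a')" "\<And>i. s < i \<Longrightarrow> c i = a' i"
      and cd: "\<And>M. add_mset a' (add_mset b M) \<leadsto> add_mset c (add_mset d M)"
      using transfer_height[OF assms(1) less.prems(1) _ b(2,3)] 2 bounds
      by (metis order.strict_trans2)
    have "same_stats M (add_mset c (add_mset d N0))"
      using less.prems(3) exchanges_invariants(1)[OF cd[of N0]]
      unfolding N0 by (rule same_stats_trans)
    moreover have "nat \<bar>int (height a) - int (height c)\<bar> < nat \<bar>int (height a) - int (height a')\<bar>"
      using 2 c by simp
    ultimately have "\<exists>N'. add_mset c (add_mset d N0) \<leadsto> add_mset a N'"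
      using less.hyps[of c "add_mset d N0"] c less.prems(2) by simp
    then show ?thesis using cd[of N0] N0 by (meson rtranclp_trans)
  next
    case 3
    have "\<exists>b\<in>#N. 0 < (if b \<in> S then max_height - height b else 0)"
      using less.prems(3) high
      by (intro sum_mset_pos_transfer[OF assms(2), of _ a'])
        (use 3 bounds less.prems(1) assms(3) in \<open>auto simp: same_stats_def\<close>)
    then obtain b where b: "b \<in># N" "b \<in> S" "height b < max_height"
      by (metis less_numeral_extra(3) zero_less_diff)
    then obtain N0 where N0: "N = add_mset b N0" by (meson mset_add)
    obtain c d where c: "c \<in> S" "Suc (height c) = height a'" "\<And>i. s < i \<Longrightarrow> c i = a' i"
      and cd: "\<And>M. add_mset b (add_mset a' M) \<leadsto> add_mset d (add_mset c M)"
      using transfer_height[OF assms(1) b(2,3) less.prems(1)] 3 bounds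
      by (metis order.strict_trans1)
    have cd': "add_mset a' N \<leadsto> add_mset c (add_mset d N0)"
      using cd[of N0] unfolding N0 by (simp add: add_mset_commute)
    have "same_stats M (add_mset c (add_mset d N0))"
      using less.prems(3) exchanges_invariants(1)[OF cd'] by (rule same_stats_trans)
    moreover have "nat \<bar>int (height a) - int (height c)\<bar> < nat \<bar>int (height a) - int (height a')\<bar>"
      using 3 c by simp
    ultimately have "\<exists>N'. add_mset c (add_mset d N0) \<leadsto> add_mset a N'"
      using less.hyps[of c "add_mset d N0"] c less.prems(2) by simp
    then show ?thesis using cd' by (meson rtranclp_trans)
  qed
qed

text \<open>If coordinate \<open>i\<close> is still wrong, the value \<open>a i\<close> occurs at some other index in \<open>S\<close>, because it
  occurs as often as in \<open>M\<close>; switch with that one.\<close>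

lemma reach_free_coords:
  assumes "a \<in># M" and "a \<in> S" and "a' \<in> S" and "label a' = label a"
    and st: "same_stats M (add_mset a' N)" and "finite P" and "P \<subseteq> free_coords"
  shows "\<exists>a'' N''. add_mset a' N \<leadsto> add_mset a'' N'' \<and> a'' \<in> S \<and> label a'' = label a \<and>
    (\<forall>i\<in>P. a'' i = a i)"
  using assms(6,7)
proof (induction P rule: finite_induct)
  case empty
  then show ?case using assms by auto
next
  case (insert i P)
  then obtain c K where cK: "add_mset a' N \<leadsto> add_mset c K" "c \<in> S" "label c = label a"
    "\<forall>j\<in>P. c j = a j" by auto
  show ?case
  proof (cases "c i = a i")
    case True
    with cK show ?thesis by auto
  next
    case False
    let ?f = "\<lambda>b. of_bool (b \<in> S \<and> b i = a i) :: nat"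
    have i: "i \<in> free_coords" "i \<in> {1..t}" using insert.prems by (auto simp: free_coords_def)
    have "?f \<in> stats"
    proof -
      have "(i, a i) \<in> (SIGMA i:free_coords. {1..r i})"
        using i S_range[OF assms(2), of i] t_range by simp
      then have "(\<lambda>(i, v) b. of_bool (b \<in> S \<and> b i = v)) (i, a i) \<in> stats"
        unfolding stats_def by blast
      then show ?thesis by simp
    qed
    with same_stats_trans[OF st exchanges_invariants(1)[OF cK(1)]]
    have "(\<Sum>x\<in>#M. ?f x) = (\<Sum>x\<in>#add_mset c K. ?f x)" by (rule same_statsD)
    moreover have "?f c < ?f a" using False assms(2) by simp
    ultimately obtain b where "b \<in># K" "0 < ?f b"
      using sum_mset_pos_transfer[OF assms(1), of ?f c K] by blast
    then have b: "b \<in># K" "b \<in> S" "b i = a i" by (simp_all split: if_splits)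
    then obtain K0 where K0: "K = add_mset b K0" by (meson mset_add)
    have "add_mset c K \<leadsto> add_mset (sw i c b) (add_mset (sw i b c) K0)"
      unfolding K0 using exchanges_switch i(2) cK(2) b(2) by blast
    with cK(1) have "add_mset a' N \<leadsto> add_mset (sw i c b) (add_mset (sw i b c) K0)"
      by (rule rtranclp_trans)
    moreover have "sw i c b \<in> S" "label (sw i c b) = label a"
      using sw_closed label_sw i cK b by auto
    moreover have "\<forall>j\<in>insert i P. sw i c b j = a j"
      using cK(4) b insert.hyps by (auto simp: sw_def)
    ultimately show ?thesis by blast
  qed
qed

lemma reach_head:
  assumes "set_mset M \<subseteq> J" and "set_mset N \<subseteq> J" and "same_stats M N" and a: "a \<in># M"
  shows "\<exists>N'. N \<leadsto> add_mset a N'"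
proof -
  have aJ: "a \<in> J" using assms by auto
  let ?f = "\<lambda>b. of_bool (label b = label a) :: nat"
  have "?f \<in> stats" using aJ unfolding stats_def by blast
  then have "(\<Sum>x\<in>#N. ?f x) = (\<Sum>x\<in>#M. ?f x)"
    using same_statsD[OF assms(3)] by simp
  moreover have "(\<Sum>x\<in>#M. ?f x) \<noteq> 0"
  proof -
    obtain M0 where "M = add_mset a M0" using a by (rule mset_add)
    then show ?thesis by simp
  qed
  ultimately have "(\<Sum>x\<in>#N. ?f x) \<noteq> 0" by simp
  then have "\<exists>b\<in>#N. label b = label a" by auto
  then obtain b N0 where b: "label b = label a" "N = add_mset b N0" by (meson mset_add)
  have bJ: "b \<in> J" using assms(2) b by auto
  show ?thesis
  proof (cases "a \<in> S")
    case False
    then have "b \<notin> S" using label_eq_S[OF aJ bJ] b by simp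
    then have "cls b = cls a" using False b by (simp add: label_def)
    then show ?thesis using exchanges_rename[OF bJ aJ] b by blast
  next
    case True
    then have "b \<in> S" using label_eq_S[OF aJ bJ] b by simp
    then obtain c K where cK: "N \<leadsto> add_mset c K" "c \<in> S" "label c = label a"
      "\<forall>i\<in>free_coords. c i = a i"
      using reach_free_coords[OF a True _ b(1), of N0 free_coords] assms(3) b
      by (auto simp: free_coords_def)
    have eq: "c i = a i" if "s < i \<or> s = 1 \<and> i \<in> {1..n}" for i
    proof -
      consider (1) "i \<in> free_coords" | (2) "i \<in> {max s t + 1..n}" | (3) "n < i"
      proof (cases "i \<le> t")
        case True
        with \<open>s < i \<or> s = 1 \<and> i \<in> {1..n}\<close> have "i \<in> free_coords"
          unfolding free_coords_def by auto
        then show thesis by (rule 1)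
      next
        case False
        with \<open>s < i \<or> s = 1 \<and> i \<in> {1..n}\<close> t_range have "max s t < i" by auto
        then show thesis using 2 3 by (cases "n < i") auto
      qed
      then show ?thesis
      proof cases
        case 2
        then show ?thesis using cK label_eq_iff_S[OF True cK(2)] by blast
      next
        case 3
        then show ?thesis using index_set_outside[OF S_J[OF cK(2)] S_J[OF True], of i] by simp
      qed (use cK in blast)
    qed
    have st: "same_stats M (add_mset c K)"
      using assms(3) exchanges_invariants(1)[OF cK(1)] by (rule same_stats_trans)
    show ?thesis
    proof (cases "s = 1")
      case True
      then have "c = a"
        using eq by (intro index_set_eqI[OF S_J[OF cK(2)] aJ]) auto
      with cK show ?thesis by blast
    next
      case False
      then have "2 \<le> s" using s_range by simp
      from reach_height[OF this a True cK(2) _ st] eq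
      show ?thesis using cK(1) by (meson rtranclp_trans)
    qed
  qed
qed

text \<open>Bring the elements of \<open>M\<close> into \<open>N\<close> one by one; moves preserve the statistics, so these still agree
  after a common element has been cancelled.\<close>

theorem exchanges_if_same_stats:
  assumes "set_mset M \<subseteq> J" and "set_mset N \<subseteq> J" and "same_stats M N"
  shows "N \<leadsto> M"
  using assms
proof (induction M arbitrary: N)
  case empty
  have "N = {#}"
  proof (rule ccontr)
    assume "N \<noteq> {#}"
    then obtain a where "a \<in># N" by blast
    with reach_head[of N "{#}" a] empty obtain N' where "{#} \<leadsto> add_mset a N'"
      by (auto simp: same_stats_def)
    then show False
      by (cases rule: converse_rtranclpE) (auto elim: exchange.cases)
  qed
  then show ?case by simp
next
  case (add a M)
  obtain N' where N': "N \<leadsto> add_mset a N'"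
    using reach_head[OF add.prems] by auto
  have "same_stats M N'" "set_mset N' \<subseteq> J"
    using exchanges_invariants[OF N'] add.prems by (auto simp: same_stats_def)
  then have "N' \<leadsto> M" using add by simp
  from N' exchanges_add[OF this] show ?case by (rule rtranclp_trans)
qed

section \<open>Primality\<close>

abbreviation var_prod :: "multi_index multiset \<Rightarrow> (multi_index set, 'k::field) mpoly" where
  "var_prod M \<equiv> (\<Prod>C\<in>#image_mset cls M. mpoly_var C)"

lemma var_prod_carrier: "set_mset M \<subseteq> J \<Longrightarrow> var_prod M \<in> carrier (R_ring n r s)"
  by (auto simp: R_ring_def prod_mpoly_var keys_mset_monom)

definition gens :: "(multi_index set, 'k::field) mpoly set" where
  "gens = {f_poly n r s i a b | i a b. i \<in> {1..t} \<and> a \<in> S \<and> b \<in> S \<and> connected_in n S a b}"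

lemma I_tilde_gens: "I_tilde n r s t S = genideal (R_ring n r s) gens"
  by (simp add: I_tilde_def gens_def)

lemma f_poly_var_prod:
  "f_poly n r s i a b = var_prod {#a, b#} - var_prod {#sw i a b, sw i b a#}"
  by (simp add: f_poly_def x_var_def)

lemma gens_carrier: "gens \<subseteq> carrier (R_ring n r s :: (multi_index set, 'k::field) mpoly ring)"
proof
  fix g :: "(multi_index set, 'k) mpoly" assume "g \<in> gens"
  then obtain i a b where g: "g = f_poly n r s i a b" and iab: "i \<in> {1..t}" "a \<in> S" "b \<in> S"
    unfolding gens_def by blast
  have "var_prod {#a, b#} \<in> carrier (R_ring n r s)"
    "var_prod {#sw i a b, sw i b a#} \<in> carrier (R_ring n r s)"
    using iab sw_closed S_J by (intro var_prod_carrier; auto)+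
  then show "g \<in> carrier (R_ring n r s)"
    unfolding g f_poly_var_prod R_ring_def by (rule mpoly_carrier_minus)
qed

lemma ideal_I_tilde:
  "ideal (I_tilde n r s t S) (R_ring n r s :: (multi_index set, 'k::field) mpoly ring)"
proof -
  interpret R: cring "R_ring n r s :: (multi_index set, 'k) mpoly ring"
    unfolding R_ring_def by (rule cring_mpoly_ring)
  show ?thesis unfolding I_tilde_gens by (rule R.genideal_ideal[OF gens_carrier])
qed

lemma exchange_I_tilde:
  assumes "exchange M N" and "set_mset M \<subseteq> J"
  shows "var_prod M - var_prod N \<in> (I_tilde n r s t S :: (multi_index set, 'k::field) mpoly set)"
proof -
  let ?R = "R_ring n r s :: (multi_index set, 'k) mpoly ring"
  let ?I = "I_tilde n r s t S :: (multi_index set, 'k) mpoly set"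
  interpret R: cring ?R unfolding R_ring_def by (rule cring_mpoly_ring)
  interpret I: ideal ?I ?R by (rule ideal_I_tilde)
  show ?thesis using assms
  proof (induction rule: exchange.induct)
    case (switch i a b M)
    have "f_poly n r s i a b \<in> ?I"
      using R.genideal_self[OF gens_carrier] switch connected
      unfolding I_tilde_gens gens_def connected_set_def by blast
    moreover have "var_prod M \<in> carrier ?R"
      using switch by (intro var_prod_carrier) auto
    ultimately have "var_prod M * f_poly n r s i a b \<in> ?I"
      using I.I_l_closed[of "f_poly n r s i a b" "var_prod M"] by (simp add: R_ring_def)
    then show ?case by (simp add: f_poly_def x_var_def algebra_simps)
  next
    case (rename a b M)
    then show ?case using I.zero_closed by (simp add: R_ring_def)
  qed
qed

lemma exchanges_I_tilde:
  assumes "M \<leadsto> N" and "set_mset M \<subseteq> J"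
  shows "var_prod M - var_prod N \<in> (I_tilde n r s t S :: (multi_index set, 'k::field) mpoly set)"
  using assms
proof (induction rule: rtranclp_induct)
  case base
  show ?case using ideal_I_tilde[THEN ideal.axioms(1), THEN additive_subgroup.zero_closed]
    by (simp add: R_ring_def)
next
  case (step N P)
  have "set_mset N \<subseteq> J" using exchanges_invariants(2)[OF step.hyps(1)] step.prems by blast
  from exchange_I_tilde[OF step.hyps(2) this] step
  show ?case
    using additive_subgroup.a_closed[OF ideal.axioms(1)[OF ideal_I_tilde],
        of "var_prod M - var_prod N" "var_prod N - var_prod P"]
    by (simp add: R_ring_def)
qed

text \<open>The criterion wants functions of the variables, that is, of the classes. The statistics are constant
  on classes, so any choice of representatives yields them.\<close>

definition class_stat :: "(multi_index \<Rightarrow> nat) \<Rightarrow> multi_index set \<Rightarrow> nat" where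
  "class_stat f C = f (SOME a. a \<in> J \<and> cls a = C)"

lemma class_stat_cls:
  assumes "f \<in> stats" and "a \<in> J"
  shows "class_stat f (cls a) = f a"
proof -
  have "\<exists>b. b \<in> J \<and> cls b = cls a" using assms(2) by blast
  from someI_ex[OF this] show ?thesis
    unfolding class_stat_def using stats_cls[OF assms(1) _ assms(2)] by blast
qed

lemma sum_class_stat:
  assumes "f \<in> stats" and "set_mset M \<subseteq> J"
  shows "(\<Sum>C\<in>#image_mset cls M. class_stat f C) = (\<Sum>a\<in>#M. f a)"
  using assms(2) by (induction M) (simp_all add: class_stat_cls[OF assms(1)])

lemma representatives:
  assumes "set_mset A \<subseteq> cls ` J"
  obtains M where "set_mset M \<subseteq> J" and "A = image_mset cls M"
proof
  let ?M = "image_mset (inv_into J cls) A"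
  show "set_mset ?M \<subseteq> J" using assms by (auto intro: inv_into_into)
  have "image_mset (\<lambda>C. cls (inv_into J cls C)) A = image_mset (\<lambda>C. C) A"
    by (rule image_mset_cong, rule f_inv_into_f[where f = cls and A = J]) (use assms in auto)
  then show "A = image_mset cls ?M" by (simp add: multiset.map_comp comp_def)
qed

theorem primeideal_I_tilde:
  "primeideal (I_tilde n r s t S) (R_ring n r s :: (multi_index set, 'k::field) mpoly ring)"
  unfolding I_tilde_gens R_ring_def
proof (rule primeideal_toric)
  show "finite (class_stat ` stats)" using finite_stats by simp
next
  fix g :: "(multi_index set, 'k) mpoly" assume "g \<in> gens"
  then obtain i a b where g: "g = f_poly n r s i a b" and iab: "i \<in> {1..t}" "a \<in> S" "b \<in> S"
    unfolding gens_def by blast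
  let ?M = "{#a, b#}" and ?N = "{#sw i a b, sw i b a#}"
  have J: "set_mset ?M \<subseteq> J" "set_mset ?N \<subseteq> J" using iab sw_closed S_J by auto
  have "(\<Sum>C\<in>#image_mset cls ?M. f C) = (\<Sum>C\<in>#image_mset cls ?N. f C)"
    if f: "f \<in> class_stat ` stats" for f
  proof -
    obtain h where h: "h \<in> stats" "f = class_stat h" using f by blast
    show ?thesis
      unfolding h(2) sum_class_stat[OF h(1) J(1)] sum_class_stat[OF h(1) J(2)]
      using stats_sw[OF h(1) iab] by simp
  qed
  with J show "\<exists>A B. set_mset A \<subseteq> cls ` J \<and> set_mset B \<subseteq> cls ` J \<and>
      g = (\<Prod>v\<in>#A. mpoly_var v) - (\<Prod>v\<in>#B. mpoly_var v) \<and>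
      (\<forall>f\<in>class_stat ` stats. (\<Sum>v\<in>#A. f v) = (\<Sum>v\<in>#B. f v))"
    unfolding g f_poly_var_prod
    by (intro exI[of _ "image_mset cls ?M"] exI[of _ "image_mset cls ?N"]) auto
next
  fix A B :: "multi_index set multiset"
  assume "set_mset A \<subseteq> cls ` J" and "set_mset B \<subseteq> cls ` J"
    and eq: "\<And>f. f \<in> class_stat ` stats \<Longrightarrow> (\<Sum>v\<in>#A. f v) = (\<Sum>v\<in>#B. f v)"
  then obtain M N where M: "set_mset M \<subseteq> J" "A = image_mset cls M"
    and N: "set_mset N \<subseteq> J" "B = image_mset cls N"
    by (meson representatives)
  have "same_stats N M"
    unfolding same_stats_def
  proof
    fix f assume f: "f \<in> stats"
    then show "(\<Sum>a\<in>#N. f a) = (\<Sum>a\<in>#M. f a)"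
      using eq[of "class_stat f"] sum_class_stat[OF f M(1)] sum_class_stat[OF f N(1)]
      unfolding M(2) N(2) by simp
  qed
  then have "M \<leadsto> N" using exchanges_if_same_stats M N by blast
  from exchanges_I_tilde[OF this M(1)]
  show "(\<Prod>v\<in>#A. mpoly_var v) - (\<Prod>v\<in>#B. mpoly_var v) \<in> genideal (mpoly_ring (cls ` J)) gens"
    unfolding M(2) N(2) I_tilde_gens R_ring_def .
qed

end

theorem proposition3p9:
  fixes n s t :: nat and r :: "nat \<Rightarrow> nat" and S :: "multi_index set"
  assumes "n \<ge> 1" and "\<forall>i\<in>{1..n}. r i \<ge> 2" and "s \<in> {1..n}" and "t \<in> {1..n}"
    and "switchable n r s t S" and "connected_set n S"
  shows "primeideal (I_tilde n r s t S) (R_ring n r s :: (multi_index set, 'k::field) mpoly ring)"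
proof -
  interpret connected_switchable n s t r S
    using assms by unfold_locales auto
  show ?thesis by (rule primeideal_I_tilde)
qed

end
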